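(* For all integers $n\ge 1$ and $k\ge 1$, the number of divisions of a honeycomb strip of length $n$ into exactly $k$ pieces is $$d_k(n)=\binom{n+k-2}{n-k}.$$ The number $s_k(n)$ of divisions of the honeycomb strip of length $n$ into exactly $k$ pieces such that the two last hexagons $n-1$ and $n$ belong to different pieces is $0$ if $n=1$, and for $n\ge 2$ it equals $$s_k(n)=\binom{n+k-3}{n-k}.$$ (Here $\binom{a}{b}=0$ when $b<0$.)
   Context: A honeycomb strip of length $n$ consists of $n$ hexagons labelled $1,\dots,n$ in which hexagon $i$ is adjacent exactly with hexagons $i\pm1$ and $i\pm2$ (when these exist); equivalently its inner dual is the graph $P_n^2$ on vertices $1,\dots,n$ with $i\sim j$ iff $1\le|i-j|\le2$. A division into $k$ pieces is a partition of the hexagons into $k$ blocks each inducing a connected subgraph of $P_n^2$. *)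

theory Defs
  imports
    "HOL-Library.Disjoint_Sets"
    "Graph_Theory.Digraph_Component"
    "Graph_Theory.Pair_Digraph"
begin

text \<open>An undirected graph is a symmetric digraph: both orientations of every edge are arcs.\<close>

definition strip :: "nat \<Rightarrow> nat pair_pre_digraph" where
  "strip n = \<lparr> pverts = {1..n},
     parcs = {(i, j). i \<in> {1..n} \<and> j \<in> {1..n} \<and>
                      1 \<le> \<bar>int i - int j\<bar> \<and> \<bar>int i - int j\<bar> \<le> 2} \<rparr>"

lemma pair_graph_strip: "pair_graph (strip n)"
proof
  show "finite (parcs (strip n))"
    by (rule finite_subset[of _ "{1..n} \<times> {1..n}"]) (auto simp: strip_def)
qed (auto simp: strip_def symmetric_def intro!: symI)

text \<open>The qualified name avoids the topological notion of the same name.\<close>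

definition divisions :: "nat \<Rightarrow> nat \<Rightarrow> nat set set set" where
  "divisions n k = {P. partition_on {1..n} P \<and> card P = k \<and>
     (\<forall>A\<in>P. Digraph_Component.connected (with_proj (strip n) \<restriction> A))}"

definition num_divisions :: "nat \<Rightarrow> nat \<Rightarrow> nat" where
  "num_divisions k n = card (divisions n k)"

text \<open>For \<open>n = 1\<close> the label \<open>n - 1 = 0\<close> is not a hexagon and lies in no piece, so nothing is
  counted.\<close>

definition num_split_divisions :: "nat \<Rightarrow> nat \<Rightarrow> nat" where
  "num_split_divisions k n = card {P \<in> divisions n k. \<exists>A\<in>P. \<exists>B\<in>P. n - 1 \<in> A \<and> n \<in> B \<and> A \<noteq> B}"

definition binom :: "nat \<Rightarrow> int \<Rightarrow> nat" where
  "binom a b = (if b < 0 then 0 else a choose nat b)"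

end

theory Submission
  imports Defs
begin

text \<open>
  Deleting hexagon \<open>n + 1\<close> leaves a division of the strip of length \<open>n\<close>. If \<open>n + 1\<close> was a piece
  of its own, the rest is an arbitrary division with one piece fewer; if it shared a piece with \<open>n\<close>,
  the rest is an arbitrary division; otherwise it shared a piece with \<open>n - 1\<close> but not with \<open>n\<close>, and
  the rest is a division separating \<open>n - 1\<close> from \<open>n\<close>. Each case is a bijection, so
  \<open>s_k(n+1) = d_{k-1}(n) + s_k(n)\<close> and \<open>d_k(n+1) = s_k(n+1) + d_k(n)\<close>,
  which Pascal's rule solves by the stated binomial coefficients.
\<close>

section \<open>Connectedness in the strip as a bound on gaps\<close>

text \<open>Looking one element down, instead of at paths, makes it easy to follow what adding or
  removing the largest element does. The empty set qualifies, so nonemptiness is tracked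
  separately.\<close>

definition linked :: "nat set \<Rightarrow> bool" where
  "linked A \<longleftrightarrow> (\<forall>a\<in>A. \<forall>b\<in>A. a < b \<longrightarrow> (\<exists>c\<in>A. c < b \<and> b \<le> c + 2))"

text \<open>Adjacency in the strip is already symmetric, so the symmetric closure used by the
  library's connectedness adds nothing.\<close>

lemma arcs_ends_strip:
  assumes "A \<subseteq> {1..n}"
  shows "(arcs_ends (with_proj (strip n) \<restriction> A))\<^sup>s =
    {(i, j). i \<in> A \<and> j \<in> A \<and> 1 \<le> \<bar>int i - int j\<bar> \<and> \<bar>int i - int j\<bar> \<le> 2}"
    (is "_ = ?R")
proof -
  have "arcs_ends (with_proj (strip n) \<restriction> A) = {e \<in> parcs (strip n). fst e \<in> A \<and> snd e \<in> A}"
    by (simp add: arcs_ends_conv induce_subgraph_def)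
  also have "\<dots> = ?R" using assms unfolding strip_def by force
  finally have "(arcs_ends (with_proj (strip n) \<restriction> A))\<^sup>s = ?R \<union> ?R\<inverse>"
    unfolding symcl_def by force
  also have "?R\<inverse> = ?R" by (auto simp: abs_minus_commute)
  finally show ?thesis by simp
qed

text \<open>A gap below \<open>b\<close> cannot be crossed, since edges have length at most 2;
  without gaps, every element descends step by step to \<open>Min A\<close>.\<close>

lemma connected_strip_iff:
  assumes A: "A \<subseteq> {1..n}"
  shows "Digraph_Component.connected (with_proj (strip n) \<restriction> A) \<longleftrightarrow> A \<noteq> {} \<and> linked A"
proof -
  define R where "R = {(i, j). i \<in> A \<and> j \<in> A \<and> 1 \<le> \<bar>int i - int j\<bar> \<and> \<bar>int i - int j\<bar> \<le> 2}"
  have conn: "Digraph_Component.connected (with_proj (strip n) \<restriction> A) \<longleftrightarrow>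
      A \<noteq> {} \<and> (\<forall>u\<in>A. \<forall>v\<in>A. (u, v) \<in> rtrancl_on A R)"
    by (simp add: connected_conv arcs_ends_strip[OF A] R_def)
  have "linked A" if reach: "\<forall>u\<in>A. \<forall>v\<in>A. (u, v) \<in> rtrancl_on A R"
    unfolding linked_def
  proof (intro ballI impI)
    fix a b assume ab: "a \<in> A" "b \<in> A" "a < b"
    show "\<exists>c\<in>A. c < b \<and> b \<le> c + 2"
    proof (rule ccontr)
      assume none: "\<not> ?thesis"
      have "(a, b) \<in> rtrancl_on A R" using reach ab by blast
      \<comment> \<open>Being below \<open>b\<close> is invariant along the walk: an edge from
        \<open>x < b\<close> to some \<open>y \<ge> b\<close> would give
        \<open>b \<le> x + 2\<close>, making \<open>x\<close> the excluded witness.\<close>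
      then have "b < b"
        by (rule rtrancl_on_induct[where P = "\<lambda>x. x < b"]) (use ab none in \<open>auto simp: R_def\<close>)
      then show False by simp
    qed
  qed
  moreover have "(u, v) \<in> rtrancl_on A R" if "linked A" "u \<in> A" "v \<in> A" for u v
  proof -
    have fin: "finite A" using A finite_subset by blast
    have min: "Min A \<in> A" using fin \<open>u \<in> A\<close> by (auto intro!: Min_in)
    \<comment> \<open>Both directions are carried through the induction, so that any two vertices
      can be joined via \<open>Min A\<close>.\<close>
    have up: "(Min A, x) \<in> rtrancl_on A R \<and> (x, Min A) \<in> rtrancl_on A R" if "x \<in> A" for x
      using that
    proof (induction x rule: less_induct)
      case (less x)
      show ?case
      proof (cases "x = Min A")
        case True
        then show ?thesis using less.prems by simp
      next
        case False
        then have "Min A < x" using less.prems fin by (simp add: order_less_le)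
        then obtain c where c: "c \<in> A" "c < x" "x \<le> c + 2"
          using \<open>linked A\<close> less.prems min unfolding linked_def by blast
        then have "(c, x) \<in> R" "(x, c) \<in> R" using less.prems by (auto simp: R_def)
        with less.IH[OF c(2,1)] c less.prems show ?thesis
          by (meson rtrancl_on_into_rtrancl_on converse_rtrancl_on_into_rtrancl_on)
      qed
    qed
    show ?thesis using up[OF \<open>u \<in> A\<close>] up[OF \<open>v \<in> A\<close>] rtrancl_on_trans by metis
  qed
  ultimately show ?thesis using conn by blast
qed

text \<open>Blocks of a partition are nonempty, so only \<open>linked\<close> remains of
  connectedness; from here on the graph is no longer needed.\<close>

lemma divisions_eq:
  "divisions n k = {P. partition_on {1..n} P \<and> card P = k \<and> (\<forall>A\<in>P. linked A)}"
proof -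
  have "Digraph_Component.connected (with_proj (strip n) \<restriction> A) \<longleftrightarrow> linked A"
    if "partition_on {1..n} P" "A \<in> P" for A P
  proof -
    have "A \<subseteq> {1..n}" "A \<noteq> {}" using that by (auto simp: partition_on_def)
    then show ?thesis using connected_strip_iff by simp
  qed
  then show ?thesis unfolding divisions_def by blast
qed

lemma finite_divisions: "finite (divisions n k)"
  by (rule finite_subset[OF _ finitely_many_partition_on[of "{1..n}"]]) (auto simp: divisions_eq)

text \<open>\<open>Suc n\<close> lies above all of \<open>A\<close> and so is a predecessor of
  nothing. The only new condition is that \<open>Suc n\<close>, unless it is the minimum, has
  \<open>n\<close> or \<open>n - 1\<close> below it.\<close>

lemma linked_insert_Suc:
  assumes "A \<subseteq> {1..n}"
  shows "linked (insert (Suc n) A) \<longleftrightarrow> linked A \<and> (A = {} \<or> n \<in> A \<or> n - 1 \<in> A)" (is "?L \<longleftrightarrow> ?R")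
proof
  assume L: ?L
  have "linked A"
    unfolding linked_def
  proof (intro ballI impI)
    fix a b assume ab: "a \<in> A" "b \<in> A" "a < b"
    then have "b \<le> n" using assms by auto
    obtain c where "c \<in> insert (Suc n) A" "c < b" "b \<le> c + 2"
      using L ab unfolding linked_def by blast
    then show "\<exists>c\<in>A. c < b \<and> b \<le> c + 2" using \<open>b \<le> n\<close> by auto
  qed
  moreover have "n \<in> A \<or> n - 1 \<in> A" if "a \<in> A" for a
  proof -
    have "a < Suc n" using that assms by auto
    then obtain c where "c \<in> A" "c < Suc n" "Suc n \<le> c + 2"
      using L[unfolded linked_def, rule_format, of a "Suc n"] \<open>a \<in> A\<close> \<open>a < Suc n\<close> by auto
    moreover from this have "c = n \<or> c = n - 1" by linarith
    ultimately show ?thesis by blast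
  qed
  ultimately show ?R by blast
next
  assume R: ?R
  show ?L
    unfolding linked_def
  proof (intro ballI impI)
    fix a b assume ab: "a \<in> insert (Suc n) A" "b \<in> insert (Suc n) A" "a < b"
    then have "a \<in> A" using assms by auto
    show "\<exists>c\<in>insert (Suc n) A. c < b \<and> b \<le> c + 2"
    proof (cases "b \<in> A")
      case True
      then show ?thesis using R ab \<open>a \<in> A\<close> unfolding linked_def by blast
    next
      case False
      then have b: "b = Suc n" using ab by simp
      obtain c where "c \<in> A" "c = n \<or> c = n - 1" using R \<open>a \<in> A\<close> by blast
      then show ?thesis using b by (intro bexI[of _ c]) auto
    qed
  qed
qed

section \<open>Attaching the last hexagon to an existing piece\<close>

lemma partition_on_blocks_eq:
  assumes "partition_on S P" "A \<in> P" "B \<in> P" "x \<in> A" "x \<in> B"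
  shows "A = B"
  using assms by (auto simp: partition_on_def disjoint_def)

lemma partition_on_ex_block:
  assumes "partition_on S P" "x \<in> S"
  obtains A where "A \<in> P" "x \<in> A"
  using assms unfolding partition_on_def by blast

lemma partition_on_notin_block:
  assumes "partition_on S P" "A \<in> P" "x \<notin> S"
  shows "x \<notin> A"
  using assms by (auto simp: partition_on_def)

text \<open>The hexagon \<open>m\<close> marks the piece that receives \<open>Suc n\<close>; it will
  be \<open>n\<close> or \<open>n - 1\<close>. Acting on every block avoids choosing the one that
  contains \<open>m\<close>.\<close>

definition attach :: "nat \<Rightarrow> nat \<Rightarrow> nat set set \<Rightarrow> nat set set" where
  "attach n m P = (\<lambda>A. if m \<in> A then insert (Suc n) A else A) ` P"

lemma image_Diff_attach:
  assumes "partition_on {1..n} P"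
  shows "(\<lambda>A. A - {Suc n}) ` attach n m P = P"
proof -
  have "Suc n \<notin> A" if "A \<in> P" for A using partition_on_notin_block[OF assms that] by simp
  then have "(if m \<in> A then insert (Suc n) A else A) - {Suc n} = A" if "A \<in> P" for A
    using that by auto
  then show ?thesis by (simp add: attach_def image_image del: if_image_distrib)
qed

text \<open>The bounds leave only \<open>m = n\<close> and \<open>m = n - 1\<close>, the neighbours
  of \<open>Suc n\<close>, so the enlarged block stays linked.\<close>

lemma attach_division:
  assumes m: "1 \<le> m" "m \<le> n" "n \<le> Suc m" and P: "P \<in> divisions n k"
  shows "attach n m P \<in> divisions (Suc n) k" "\<exists>A\<in>attach n m P. {m, Suc n} \<subseteq> A"
proof -
  let ?f = "\<lambda>A. if m \<in> A then insert (Suc n) A else A"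
  have part: "partition_on {1..n} P" and "card P = k" and lk: "\<And>A. A \<in> P \<Longrightarrow> linked A"
    using P by (auto simp: divisions_eq)
  have sub: "A \<subseteq> {1..n}" if "A \<in> P" for A using that part by (auto simp: partition_on_def)
  obtain M where M: "M \<in> P" "m \<in> M"
      using partition_on_ex_block[OF part, of "m"] m by auto
  show ex: "\<exists>A\<in>attach n m P. {m, Suc n} \<subseteq> A"
    using M by (intro bexI[of _ "insert (Suc n) M"]) (auto simp: attach_def image_iff)
  \<comment> \<open>Deleting \<open>Suc n\<close> inverts \<open>?f\<close> on blocks, so no two
    pieces merge and the count stays \<open>k\<close>.\<close>
  have "inj_on ?f P"
    by (rule inj_on_inverseI[where g = "\<lambda>A. A - {Suc n}"]) (use partition_on_notin_block[OF part] in auto)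
  then have "card (attach n m P) = k" using \<open>card P = k\<close> by (simp add: attach_def card_image del: if_image_distrib)
  moreover have "linked B" if "B \<in> attach n m P" for B
  proof -
    obtain A where A: "A \<in> P" "B = ?f A" using \<open>B \<in> attach n m P\<close> by (auto simp: attach_def)
    moreover have "m = n \<or> m = n - 1" using m by linarith
    ultimately show ?thesis using linked_insert_Suc[OF sub[OF A(1)]] lk by auto
  qed
  moreover have "partition_on {1..Suc n} (attach n m P)"
  proof (rule partition_onI)
    show "\<Union> (attach n m P) = {1..Suc n}"
    proof
      show "\<Union> (attach n m P) \<subseteq> {1..Suc n}" using sub by (fastforce simp: attach_def split: if_splits)
      show "{1..Suc n} \<subseteq> \<Union> (attach n m P)"
      proof
        fix x assume x: "x \<in> {1..Suc n}"
        show "x \<in> \<Union> (attach n m P)"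
        proof (cases "x = Suc n")
          case True then show ?thesis using ex by auto
        next
          case False
          then obtain A where "A \<in> P" "x \<in> A"
            using x partition_on_ex_block[OF part, of x] by auto
          then show ?thesis by (auto simp: attach_def)
        qed
      qed
    qed
  next
    fix B C assume B: "B \<in> attach n m P" and C: "C \<in> attach n m P" and "B \<noteq> C"
    obtain X Y where X: "X \<in> P" "B = ?f X" and Y: "Y \<in> P" "C = ?f Y"
      using B C by (auto simp: attach_def)
    have "X \<noteq> Y" using X Y \<open>B \<noteq> C\<close> by blast
    then have "X \<inter> Y = {}" using partition_on_blocks_eq[OF part] X Y by blast
    moreover have "Suc n \<notin> X" "Suc n \<notin> Y" using partition_on_notin_block[OF part] X Y by simp_all
    ultimately show "disjnt B C" using X Y by (auto simp: disjnt_def)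
  next
    show "{} \<notin> attach n m P"
      using part by (auto simp: attach_def partition_on_def split: if_splits)
  qed
  ultimately show "attach n m P \<in> divisions (Suc n) k" by (simp add: divisions_eq)
qed

text \<open>The block of \<open>Suc n\<close> also contains \<open>m\<close>, which identifies it
  after the deletion and keeps it nonempty. Removing the largest element takes away no
  predecessor.\<close>

lemma detach_division:
  assumes m: "1 \<le> m" "m \<le> n" and P: "P \<in> divisions (Suc n) k"
    and M: "M \<in> P" "m \<in> M" "Suc n \<in> M"
  shows "(\<lambda>A. A - {Suc n}) ` P \<in> divisions n k" "attach n m ((\<lambda>A. A - {Suc n}) ` P) = P"
proof -
  let ?h = "\<lambda>A. A - {Suc n}"
  have part: "partition_on {1..Suc n} P" and "card P = k" and lk: "\<And>A. A \<in> P \<Longrightarrow> linked A"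
    using P by (auto simp: divisions_eq)
  have sub: "A \<subseteq> {1..Suc n}" if "A \<in> P" for A using that part by (auto simp: partition_on_def)
  have uniq: "A = M" if "A \<in> P" "m \<in> A \<or> Suc n \<in> A" for A
    using partition_on_blocks_eq[OF part] M that by blast
  have inv: "(if m \<in> ?h A then insert (Suc n) (?h A) else ?h A) = A" if "A \<in> P" for A
    using uniq[OF that] M m by auto
  then show "attach n m (?h ` P) = P" by (simp add: attach_def image_image del: if_image_distrib)
  have "inj_on ?h P"
    by (rule inj_on_inverseI[where g = "\<lambda>A. if m \<in> A then insert (Suc n) A else A"]) (rule inv)
  then have "card (?h ` P) = k" using \<open>card P = k\<close> by (simp add: card_image)
  moreover have "linked (?h A)" if "A \<in> P" for A
  proof (cases "Suc n \<in> A")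
    case True
    have "?h A \<subseteq> {1..n}" using sub[OF that] by force
    moreover have "linked (insert (Suc n) (?h A))" using lk[OF that] True by (simp add: insert_absorb)
    ultimately show ?thesis using linked_insert_Suc by blast
  qed (use lk[OF that] in simp)
  moreover have "partition_on {1..n} (?h ` P)"
  proof (rule partition_onI)
    have "\<Union> (?h ` P) = \<Union> P - {Suc n}" by blast
    also have "\<dots> = {1..n}" using part by (auto simp: partition_on_def)
    finally show "\<Union> (?h ` P) = {1..n}" .
  next
    fix B C assume "B \<in> ?h ` P" "C \<in> ?h ` P" "B \<noteq> C"
    then show "disjnt B C" using partition_on_blocks_eq[OF part] by (auto simp: disjnt_def)
  next
    have "?h A \<noteq> {}" if "A \<in> P" for A
    proof -
      have "A \<noteq> {}" using that part by (auto simp: partition_on_def)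
      moreover have "m \<in> ?h A" if "Suc n \<in> A" using uniq[OF \<open>A \<in> P\<close>] that M m by simp
      ultimately show ?thesis by blast
    qed
    then show "{} \<notin> ?h ` P" by force
  qed
  ultimately show "?h ` P \<in> divisions n k" by (simp add: divisions_eq)
qed

lemma bij_betw_attach:
  assumes "1 \<le> m" "m \<le> n" "n \<le> Suc m"
  shows "bij_betw (attach n m) (divisions n k)
    {P \<in> divisions (Suc n) k. \<exists>A\<in>P. m \<in> A \<and> Suc n \<in> A}"
proof (rule bij_betw_byWitness[where f' = "\<lambda>P. (\<lambda>A. A - {Suc n}) ` P"])
  show "\<forall>P\<in>divisions n k. (\<lambda>A. A - {Suc n}) ` attach n m P = P"
    using image_Diff_attach by (simp add: divisions_eq)
qed (use attach_division[OF assms] detach_division[OF assms(1,2)] in auto)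

text \<open>The set behind \<open>num_split_divisions\<close>, named so that it can take part in
  bijections.\<close>

definition split_divisions :: "nat \<Rightarrow> nat \<Rightarrow> nat set set set" where
  "split_divisions n k = {P \<in> divisions n k. \<exists>A\<in>P. \<exists>B\<in>P. n - 1 \<in> A \<and> n \<in> B \<and> A \<noteq> B}"

text \<open>This restricts the attaching bijection for \<open>m = n - 1\<close>: the block that
  receives \<open>Suc n\<close> avoids \<open>n\<close> exactly when \<open>n - 1\<close> and
  \<open>n\<close> were separated before.\<close>

lemma bij_betw_attach_split:
  assumes "1 \<le> n"
  shows "bij_betw (attach n (n - 1)) (split_divisions n k)
    {P \<in> divisions (Suc n) k. \<exists>A\<in>P. n - 1 \<in> A \<and> n \<notin> A \<and> Suc n \<in> A}"
proof (cases "n = 1")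
  \<comment> \<open>Here \<open>n - 1 = 0\<close> is not a hexagon, and both sides are
    empty.\<close>
  case True
  have "split_divisions n k = {}" "{P \<in> divisions (Suc n) k. \<exists>A\<in>P. n - 1 \<in> A \<and> n \<notin> A \<and> Suc n \<in> A} = {}"
    using True by (fastforce simp: split_divisions_def divisions_eq partition_on_def)+
  then show ?thesis by (simp add: bij_betw_def)
next
  case False
  let ?T = "{P \<in> divisions (Suc n) k. \<exists>A\<in>P. n - 1 \<in> A \<and> Suc n \<in> A}"
  have n: "1 \<le> n - 1" "n - 1 \<le> n" "n \<le> Suc (n - 1)" using assms False by auto
  have split_iff: "P \<in> split_divisions n k \<longleftrightarrow> (\<exists>A\<in>attach n (n - 1) P. n - 1 \<in> A \<and> n \<notin> A \<and> Suc n \<in> A)"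
    if P: "P \<in> divisions n k" for P
  proof -
    have part: "partition_on {1..n} P" using P by (simp add: divisions_eq)
    have sub: "Suc n \<notin> A" if "A \<in> P" for A using partition_on_notin_block[OF part that] by simp
    obtain A where A: "A \<in> P" "n - 1 \<in> A"
      using partition_on_ex_block[OF part, of "n - 1"] n by auto
    obtain B where B: "B \<in> P" "n \<in> B"
      using partition_on_ex_block[OF part, of "n"] n by auto
    have uA: "X = A" if "X \<in> P" "n - 1 \<in> X" for X using partition_on_blocks_eq[OF part] A that by blast
    have uB: "X = B" if "X \<in> P" "n \<in> X" for X using partition_on_blocks_eq[OF part] B that by blast
    have "P \<in> split_divisions n k \<longleftrightarrow> n \<notin> A"
      unfolding split_divisions_def using P A B uA uB by blast
    also have "\<dots> \<longleftrightarrow> (\<exists>A\<in>attach n (n - 1) P. n - 1 \<in> A \<and> n \<notin> A \<and> Suc n \<in> A)"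
    proof
      assume "n \<notin> A"
      then show "\<exists>A\<in>attach n (n - 1) P. n - 1 \<in> A \<and> n \<notin> A \<and> Suc n \<in> A"
        using A by (intro bexI[of _ "insert (Suc n) A"]) (auto simp: attach_def image_iff)
    next
      assume "\<exists>A\<in>attach n (n - 1) P. n - 1 \<in> A \<and> n \<notin> A \<and> Suc n \<in> A"
      then obtain X where "X \<in> P" "n - 1 \<in> X" "n \<notin> X"
        unfolding attach_def using sub by (auto split: if_splits)
      then show "n \<notin> A" using uA by blast
    qed
    finally show ?thesis .
  qed
  \<comment> \<open>Both sides are put in the form of subsets of the domain and range of the
    unrestricted bijection, cut out by the predicates in \<open>split_iff\<close>.\<close>
  have "split_divisions n k = {P \<in> divisions n k. P \<in> split_divisions n k}"
    by (auto simp: split_divisions_def)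
  moreover have "{P \<in> divisions (Suc n) k. \<exists>A\<in>P. n - 1 \<in> A \<and> n \<notin> A \<and> Suc n \<in> A} =
      {P \<in> ?T. \<exists>A\<in>P. n - 1 \<in> A \<and> n \<notin> A \<and> Suc n \<in> A}"
    by blast
  ultimately show ?thesis
    using bij_betw_Collect[OF bij_betw_attach[OF n, of k], where
      Q = "\<lambda>P. \<exists>A\<in>P. n - 1 \<in> A \<and> n \<notin> A \<and> Suc n \<in> A" and P = "\<lambda>P. P \<in> split_divisions n k", OF split_iff[symmetric]]
    by simp
qed

section \<open>The last hexagon as a piece of its own\<close>

lemma linked_singleton: "linked {x}"
  by (simp add: linked_def)

text \<open>\<open>Suc n\<close> lies outside \<open>{1..n}\<close>, so its singleton is a new block
  and raises the count by exactly one; dropping it is the inverse.\<close>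

lemma bij_betw_insert_singleton:
  "bij_betw (insert {Suc n}) (divisions n k) {P \<in> divisions (Suc n) (Suc k). {Suc n} \<in> P}"
proof (rule bij_betw_byWitness[where f' = "\<lambda>P. P - {{Suc n}}"])
  have new: "{Suc n} \<notin> P" if "partition_on {1..n} P" for P
    using partition_on_notin_block[OF that, of "{Suc n}" "Suc n"] by auto
  have fin: "finite P" if "partition_on {1..n} P" for P
    using that finite_elements by blast
  show "\<forall>P\<in>divisions n k. insert {Suc n} P - {{Suc n}} = P"
    using new by (auto simp: divisions_eq)
  show "insert {Suc n} ` divisions n k \<subseteq> {P \<in> divisions (Suc n) (Suc k). {Suc n} \<in> P}"
  proof clarify
    fix P assume P: "P \<in> divisions n k"
    then have part: "partition_on {1..n} P" by (simp add: divisions_eq)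
    have "{1..Suc n} - {Suc n} = {1..n}" by auto
    moreover have "disjnt {Suc n} (\<Union> P)" using part by (auto simp: partition_on_def)
    ultimately have "partition_on {1..Suc n} (insert {Suc n} P)"
      using part by (simp add: partition_on_insert)
    then show "insert {Suc n} P \<in> divisions (Suc n) (Suc k) \<and> {Suc n} \<in> insert {Suc n} P"
      using P new[OF part] fin[OF part] by (simp add: divisions_eq linked_singleton)
  qed
  show "(\<lambda>P. P - {{Suc n}}) ` {P \<in> divisions (Suc n) (Suc k). {Suc n} \<in> P} \<subseteq> divisions n k"
  proof clarify
    fix P assume P: "P \<in> divisions (Suc n) (Suc k)" "{Suc n} \<in> P"
    then have part: "partition_on {1..Suc n} P" by (simp add: divisions_eq)
    have "partition_on {1..n} (P - {{Suc n}})"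
    proof (rule partition_onI)
      have "\<Union> (P - {{Suc n}}) = \<Union> P - {Suc n}"
        using partition_on_blocks_eq[OF part P(2)] by blast
      then show "\<Union> (P - {{Suc n}}) = {1..n}" using part by (auto simp: partition_on_def)
    qed (use part in \<open>auto simp: partition_on_def disjoint_def disjnt_def\<close>)
    then show "P - {{Suc n}} \<in> divisions n k" using P by (auto simp: divisions_eq)
  qed
qed auto

section \<open>Recurrences for the two counts\<close>

lemma last_block_cases:
  assumes "P \<in> divisions (Suc n) k" "A \<in> P" "Suc n \<in> A"
  shows "A = {Suc n} \<or> n \<in> A \<or> n - 1 \<in> A"
proof -
  have "A \<subseteq> {1..Suc n}" "linked A" using assms by (auto simp: divisions_eq partition_on_def)
  then have "A - {Suc n} \<subseteq> {1..n}" by force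
  moreover have "linked (insert (Suc n) (A - {Suc n}))" using \<open>linked A\<close> assms by (simp add: insert_absorb)
  ultimately have "A - {Suc n} = {} \<or> n \<in> A - {Suc n} \<or> n - 1 \<in> A - {Suc n}"
    by (metis linked_insert_Suc)
  then show ?thesis using \<open>Suc n \<in> A\<close> by auto
qed

text \<open>In a split division the block of \<open>Suc n\<close> avoids \<open>n\<close>, so it is
  a singleton (\<open>?S\<close>) or reaches back to \<open>n - 1\<close> (\<open>?T\<close>). Each
  family is the image of one of the bijections above.\<close>

lemma card_split_divisions_Suc:
  assumes "1 \<le> n"
  shows "card (split_divisions (Suc n) (Suc k)) = card (divisions n k) + card (split_divisions n (Suc k))"
proof -
  let ?S = "{P \<in> divisions (Suc n) (Suc k). {Suc n} \<in> P}"
  let ?T = "{P \<in> divisions (Suc n) (Suc k). \<exists>A\<in>P. n - 1 \<in> A \<and> n \<notin> A \<and> Suc n \<in> A}"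
  have "P \<in> split_divisions (Suc n) (Suc k) \<longleftrightarrow> P \<in> ?S \<union> ?T" if P: "P \<in> divisions (Suc n) (Suc k)" for P
  proof -
    have part: "partition_on {1..Suc n} P" using P by (simp add: divisions_eq)
    obtain A where A: "A \<in> P" "Suc n \<in> A"
      using partition_on_ex_block[OF part, of "Suc n"] by auto
    obtain B where B: "B \<in> P" "n \<in> B"
      using partition_on_ex_block[OF part, of "n"] assms by auto
    have uA: "X = A" if "X \<in> P" "Suc n \<in> X" for X using partition_on_blocks_eq[OF part] A that by blast
    have uB: "X = B" if "X \<in> P" "n \<in> X" for X using partition_on_blocks_eq[OF part] B that by blast
    have "P \<in> split_divisions (Suc n) (Suc k) \<longleftrightarrow> n \<notin> A"
      unfolding split_divisions_def diff_Suc_1 using P A B uA uB by blast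
    also have "\<dots> \<longleftrightarrow> A = {Suc n} \<or> n - 1 \<in> A \<and> n \<notin> A"
      using last_block_cases[OF P A] by auto
    also have "\<dots> \<longleftrightarrow> P \<in> ?S \<union> ?T"
    proof -
      have "A = {Suc n} \<longleftrightarrow> {Suc n} \<in> P" using A uA by blast
      moreover have "n - 1 \<in> A \<and> n \<notin> A \<longleftrightarrow> (\<exists>A\<in>P. n - 1 \<in> A \<and> n \<notin> A \<and> Suc n \<in> A)"
        using A uA by blast
      ultimately show ?thesis using P by blast
    qed
    finally show ?thesis .
  qed
  moreover have "split_divisions (Suc n) (Suc k) \<subseteq> divisions (Suc n) (Suc k)"
    by (auto simp: split_divisions_def)
  ultimately have "split_divisions (Suc n) (Suc k) = ?S \<union> ?T" by blast
  \<comment> \<open>Otherwise the singleton block of \<open>Suc n\<close> would also contain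
    \<open>n - 1\<close>.\<close>
  moreover have "?S \<inter> ?T = {}"
  proof -
    have False if P: "P \<in> divisions (Suc n) (Suc k)" "{Suc n} \<in> P" "A \<in> P" "n - 1 \<in> A" "Suc n \<in> A" for P A
    proof -
      have "A = {Suc n}"
        using P partition_on_blocks_eq[of _ P A "{Suc n}" "Suc n"] by (auto simp: divisions_eq)
      then show False using P by simp
    qed
    then show ?thesis by blast
  qed
  moreover have "finite ?S" "finite ?T" using finite_divisions by auto
  moreover have "card ?S = card (divisions n k)"
    using bij_betw_same_card[OF bij_betw_insert_singleton] by metis
  moreover have "card ?T = card (split_divisions n (Suc k))"
    using bij_betw_same_card[OF bij_betw_attach_split[OF assms]] by metis
  ultimately show ?thesis by (simp add: card_Un_disjoint)
qed

text \<open>The divisions that are not split have \<open>n\<close> and \<open>Suc n\<close> in one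
  block, and these are the image of \<open>attach n n\<close>.\<close>

lemma card_divisions_Suc:
  assumes "1 \<le> n"
  shows "card (divisions (Suc n) k) = card (split_divisions (Suc n) k) + card (divisions n k)"
proof -
  let ?T = "{P \<in> divisions (Suc n) k. \<exists>A\<in>P. n \<in> A \<and> Suc n \<in> A}"
  have "P \<in> split_divisions (Suc n) k \<longleftrightarrow> P \<notin> ?T" if P: "P \<in> divisions (Suc n) k" for P
  proof -
    have part: "partition_on {1..Suc n} P" using P by (simp add: divisions_eq)
    obtain A where A: "A \<in> P" "Suc n \<in> A"
      using partition_on_ex_block[OF part, of "Suc n"] by auto
    obtain B where B: "B \<in> P" "n \<in> B"
      using partition_on_ex_block[OF part, of "n"] assms by auto
    have "X = A" if "X \<in> P" "Suc n \<in> X" for X using partition_on_blocks_eq[OF part] A that by blast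
    moreover have "X = B" if "X \<in> P" "n \<in> X" for X using partition_on_blocks_eq[OF part] B that by blast
    ultimately show ?thesis
      unfolding split_divisions_def diff_Suc_1 using P A B by blast
  qed
  then have "divisions (Suc n) k = split_divisions (Suc n) k \<union> ?T"
    "split_divisions (Suc n) k \<inter> ?T = {}"
    by (auto simp: split_divisions_def)
  moreover have "finite (split_divisions (Suc n) k)" "finite ?T"
    using finite_divisions by (auto simp: split_divisions_def)
  moreover have "card ?T = card (divisions n k)"
    using bij_betw_same_card[OF bij_betw_attach[of n n k]] assms by simp
  ultimately show ?thesis by (metis (no_types, lifting) card_Un_disjoint)
qed

section \<open>Boundary values and solution of the recurrences\<close>

lemma divisions_0:
  assumes "1 \<le> n"
  shows "divisions n 0 = {}"
proof -
  have "card P \<noteq> 0" if part: "partition_on {1..n} P" for P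
    using partition_on_ex_block[OF part, of n] finite_elements[OF _ part] assms by auto
  then show ?thesis by (auto simp: divisions_eq)
qed

lemma divisions_1: "divisions (Suc 0) k = (if k = 1 then {{{1}}} else {})"
proof -
  have iff: "partition_on {1::nat} P \<longleftrightarrow> P = {{1}}" for P
  proof
    assume part: "partition_on {1} P"
    have "A = {1}" if "A \<in> P" for A
    proof -
      have "A \<subseteq> {1}" "A \<noteq> {}" using that part unfolding partition_on_def by blast+
      then show ?thesis by blast
    qed
    moreover obtain A where "A \<in> P" using partition_on_ex_block[OF part, of 1] by blast
    ultimately show "P = {{1}}" by blast
  qed (simp add: partition_on_space)
  have "P \<in> divisions (Suc 0) k \<longleftrightarrow> P = {{1}} \<and> k = 1" for P
    using iff[of P] by (auto simp: divisions_eq linked_singleton)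
  then show ?thesis by (simp add: set_eq_iff)
qed

lemma split_divisions_1: "split_divisions (Suc 0) k = {}"
  by (simp add: split_divisions_def divisions_1)

text \<open>The indices are shifted so that no subtraction truncates.\<close>

lemma card_divisions_formula:
  "card (divisions (Suc n) (Suc k)) = (if k \<le> n then (n + k) choose (n - k) else 0) \<and>
   card (split_divisions (Suc (Suc n)) (Suc k)) =
     (if k \<le> Suc n then (n + k) choose (Suc n - k) else 0)"
proof (induction n arbitrary: k)
  case 0
  \<comment> \<open>The split count at length 2 comes from the recurrence at length 1, where no
    division is split.\<close>
  then show ?case
    using card_split_divisions_Suc[of 1 k] by (auto simp: divisions_1 split_divisions_1)
next
  case (Suc n)
  \<comment> \<open>This is proved first because the split recurrence at the next length uses
    it.\<close>
  have d: "card (divisions (Suc (Suc n)) (Suc k)) =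
      (if k \<le> Suc n then (Suc n + k) choose (Suc n - k) else 0)" for k
  proof (cases "k \<le> n")
    case True
    \<comment> \<open>With this substitution the differences become sums and Pascal's rule
      applies.\<close>
    then obtain i where "n = k + i" using le_Suc_ex by blast
    then show ?thesis using card_divisions_Suc[of "Suc n" "Suc k", simplified] Suc.IH[of k] by simp
  next
    case False
    then show ?thesis using card_divisions_Suc[of "Suc n" "Suc k", simplified] Suc.IH[of k]
      by (auto simp: le_Suc_eq)
  qed
  have "card (split_divisions (Suc (Suc (Suc n))) (Suc k)) =
      card (divisions (Suc (Suc n)) k) + card (split_divisions (Suc (Suc n)) (Suc k))"
    by (rule card_split_divisions_Suc) simp
  also have "\<dots> = (if k \<le> Suc (Suc n) then (Suc n + k) choose (Suc (Suc n) - k) else 0)"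
  proof (cases k)
    case 0
    \<comment> \<open>Both sides vanish: there are no divisions into zero pieces, and the lower
      indices of the binomials exceed the upper ones.\<close>
    then show ?thesis using Suc.IH[of k] by (simp add: divisions_0)
  next
    case (Suc j)
    show ?thesis
    proof (cases "k \<le> Suc n")
      case True
      then obtain i where "n = j + i" using \<open>k = Suc j\<close> le_Suc_ex by blast
      then show ?thesis using Suc.IH[of k] d[of j] \<open>k = Suc j\<close> by simp
    next
      case False
      \<comment> \<open>Only \<open>k = Suc (Suc n)\<close> gives a nonzero value: \<open>d\<close>
        contributes 1, the division into singletons.\<close>
      then show ?thesis using Suc.IH[of k] d[of j] \<open>k = Suc j\<close> by (auto simp: le_Suc_eq)
    qed
  qed
  finally show ?case using d by blast
qed

text \<open>The case \<open>k > n\<close> is exactly that of a negative lower index; this translates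
  the integer convention into the case distinction of the formula.\<close>

lemma binom_int_diff: "binom a (int n - int k) = (if k \<le> n then a choose (n - k) else 0)"
  by (auto simp: binom_def nat_diff_distrib')

theorem theorem9:
  fixes n k :: nat
  assumes "n \<ge> 1" and "k \<ge> 1"
  shows "num_divisions k n = binom (n + k - 2) (int n - int k) \<and>
         num_split_divisions k n = (if n = 1 then 0 else binom (n + k - 3) (int n - int k))"
proof -
  obtain m j where mj: "n = Suc m" "k = Suc j"
    using assms by (metis Suc_le_D One_nat_def)
  have split: "num_split_divisions k n = card (split_divisions n k)"
    by (simp add: num_split_divisions_def split_divisions_def)
  have "num_divisions k n = binom (n + k - 2) (int n - int k)"
    unfolding binom_int_diff
    using card_divisions_formula[of m j] mj by (simp add: num_divisions_def)
  moreover have "num_split_divisions k n = (if n = 1 then 0 else binom (n + k - 3) (int n - int k))"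
  proof (cases m)
    case 0
    then show ?thesis using mj split split_divisions_1 by simp
  next
    case (Suc l)
    \<comment> \<open>Now \<open>n = l + 2\<close> and \<open>k = j + 1\<close>, so
      \<open>n + k - 3 = l + j\<close> without truncation.\<close>
    then show ?thesis
      unfolding binom_int_diff
      using card_divisions_formula[of l j] mj split by simp
  qed
  ultimately show ?thesis by blast
qed

end
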